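(* Let $(\mathcal{B},\mu)$ be a strictly positive atomless normalized measure algebra. Define on $[0,1]^2$ the operations $T_{\mathrm L}(x,y)=(x+y-1)^+$, $T_{\mathrm G}(x,y)=\min\{x,y\}$, $T_{\mathrm P}(x,y)=xy$. (i) For all $x,y\in[0,1]$, the least element of $x\star y$ is $T_{\mathrm L}(x,y)$ and the greatest element of $x\star y$ is $T_{\mathrm G}(x,y)$. Independent product composition gives $T_{\mathrm P}$: for probability measures $\mu_1,\mu_2$ and events $a,b$ of the respective factors with $\mu_1(a)=x$ and $\mu_2(b)=y$, one has $(\mu_1\otimes\mu_2)(a\times b)=T_{\mathrm P}(x,y)$. (ii) The residua of these operations are, for all $x,y\in[0,1]$: $x\Rightarrow_{\mathrm L}y=\min\{1,1-x+y\}$; $x\Rightarrow_{\mathrm G}y=1$ if $x\le y$ and $x\Rightarrow_{\mathrm G}y=y$ otherwise; $x\Rightarrow_{\mathrm P}y=1$ if $x\le y$ and $x\Rightarrow_{\mathrm P}y=y/x$ otherwise. (iii) Among the three residual negations $x\mapsto(x\Rightarrow 0)$, only that of $T_{\mathrm L}$ equals $1-x$ for all $x\in[0,1]$.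
   Context: A strictly positive atomless normalized measure algebra $(\mathcal{B},\mu)$ is a Dedekind $\sigma$-complete Boolean algebra $\mathcal{B}$ with a countably additive $\mu:\mathcal{B}\to[0,1]$ such that $\mu(1)=1$, $\mu(a)>0$ for every $a\neq 0$, and $\mathcal{B}$ has no atoms. For $x,y\in[0,1]$, $x\star y:=\{\mu(a\wedge b): a,b\in\mathcal{B},\ \mu(a)=x,\ \mu(b)=y\}$. The residuum of $T:[0,1]^2\to[0,1]$ is $x\Rightarrow_T y:=$ the greatest $z\in[0,1]$ with $T(x,z)\le y$. Here $t^+=\max\{t,0\}$. *)

theory Defs
  imports "HOL-Probability.Probability" "HOL-Library.Countable_Complete_Lattices"
begin

definition is_atom :: "'a::boolean_algebra \<Rightarrow> bool" where
  "is_atom a \<longleftrightarrow> a \<noteq> bot \<and> (\<forall>b\<le>a. b = bot \<or> b = a)"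

(* Dedekind sigma-completeness is the sort countable_complete_lattice: in a Boolean algebra
   every subset is bounded, so conditional and unconditional countable completeness agree. *)
locale atomless_measure_algebra =
  fixes \<mu> :: "'a::{boolean_algebra, countable_complete_lattice} \<Rightarrow> real"
  assumes unit_interval: "\<mu> a \<in> {0..1}"
    and countably_additive:
      "(\<And>m n. m \<noteq> n \<Longrightarrow> inf (A m) (A n) = bot) \<Longrightarrow> (\<lambda>n. \<mu> (A n)) sums \<mu> (SUP n::nat. A n)"
    and normalized: "\<mu> top = 1"
    and strictly_positive: "a \<noteq> bot \<Longrightarrow> 0 < \<mu> a"
    and atomless: "\<not> is_atom a"

definition star :: "('a::boolean_algebra \<Rightarrow> real) \<Rightarrow> real \<Rightarrow> real \<Rightarrow> real set" where
  "star \<mu> x y = {\<mu> (inf a b) | a b. \<mu> a = x \<and> \<mu> b = y}"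

definition is_least :: "real set \<Rightarrow> real \<Rightarrow> bool" where
  "is_least S m \<longleftrightarrow> m \<in> S \<and> (\<forall>s\<in>S. m \<le> s)"

definition is_greatest :: "real set \<Rightarrow> real \<Rightarrow> bool" where
  "is_greatest S m \<longleftrightarrow> m \<in> S \<and> (\<forall>s\<in>S. s \<le> m)"

(* The operations below are written on all reals; only their values on the unit square matter. *)
definition T_L :: "real \<Rightarrow> real \<Rightarrow> real" where
  "T_L x y = max (x + y - 1) 0"

definition T_G :: "real \<Rightarrow> real \<Rightarrow> real" where
  "T_G x y = min x y"

definition T_P :: "real \<Rightarrow> real \<Rightarrow> real" where
  "T_P x y = x * y"

(* GREATEST is unspecified when no greatest element exists, so results about residua should
   also assert that the greatest element is attained. *)
definition residuum :: "(real \<Rightarrow> real \<Rightarrow> real) \<Rightarrow> real \<Rightarrow> real \<Rightarrow> real" where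
  "residuum T x y = (GREATEST z. z \<in> {0..1} \<and> T x z \<le> y)"

definition residual_negation :: "(real \<Rightarrow> real \<Rightarrow> real) \<Rightarrow> real \<Rightarrow> real" where
  "residual_negation T x = residuum T x 0"

end

theory Submission
  imports Defs
begin

text \<open>
  The values of \<open>x \<star> y\<close> lie between the two bounds by monotonicity and modularity of the
  measure. That the bounds are attained rests on Sierpinski's theorem: an atomless measure
  takes every intermediate value on an interval of the algebra. The latter follows by a greedy
  exhaustion, enlarging an element in each step by at least half of the largest admissible
  increment; the increments tend to 0, whereas a gap below the target value would leave
  room for one fixed nonzero element.
\<close>

context atomless_measure_algebra
begin

section \<open>Finite additivity, modularity and continuity from below\<close>

lemma measure_bot: "\<mu> bot = 0"
proof -
  \<comment> \<open>The constant sequence \<open>bot\<close> is pairwise disjoint, and a constant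
    series converges only if its term is 0.\<close>
  have "(\<lambda>n::nat. \<mu> bot) sums \<mu> (SUP n::nat. bot)"
    by (rule countably_additive) simp
  then show ?thesis
    by (metis summable_const_iff sums_summable)
qed

lemma measure_sup:
  assumes "inf a b = bot"
  shows "\<mu> (sup a b) = \<mu> a + \<mu> b"
proof -
  define A where "A = (\<lambda>n::nat. if n = 0 then a else if n = 1 then b else bot)"
  have "inf (A m) (A n) = bot" if "m \<noteq> n" for m n
    using that assms by (auto simp: A_def inf_commute)
  then have "(\<lambda>n. \<mu> (A n)) sums \<mu> (SUP n. A n)"
    by (rule countably_additive)
  moreover have "(SUP n. A n) = sup a b"
  proof (rule antisym)
    show "(SUP n. A n) \<le> sup a b"
      by (rule ccSUP_least) (auto simp: A_def)
    have "A 0 \<le> (SUP n. A n)" "A 1 \<le> (SUP n. A n)"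
      by (rule ccSUP_upper; simp)+
    then show "sup a b \<le> (SUP n. A n)"
      by (simp add: A_def)
  qed
  moreover have "(\<lambda>n. \<mu> (A n)) sums (\<Sum>n\<in>{0,1}. \<mu> (A n))"
    by (rule sums_finite) (auto simp: A_def measure_bot)
  ultimately show ?thesis
    using sums_unique2 by (fastforce simp: A_def)
qed

lemma measure_diff:
  assumes "a \<le> b"
  shows "\<mu> (b - a) = \<mu> b - \<mu> a"
proof -
  have "sup a (b - a) = b"
    using assms by (simp add: diff_eq sup_inf_distrib1 sup_absorb2)
  moreover have "inf a (b - a) = bot"
    by (simp add: diff_eq inf_left_commute)
  ultimately show ?thesis
    using measure_sup[of a "b - a"] by simp
qed

lemma measure_mono: "a \<le> b \<Longrightarrow> \<mu> a \<le> \<mu> b"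
  using measure_diff[of a b] unit_interval[of "b - a"] by simp

lemma measure_sup_inf: "\<mu> (sup a b) + \<mu> (inf a b) = \<mu> a + \<mu> b"
proof -
  have "inf (a - inf a b) b = bot"
    by (simp add: diff_eq inf_sup_distrib1 inf_sup_distrib2 inf_assoc)
  moreover have "sup (a - inf a b) b = sup a b"
    by (simp add: diff_eq inf_sup_distrib1 sup_inf_distrib2)
  ultimately show ?thesis
    using measure_sup[of "a - inf a b" b] measure_diff[of "inf a b" a] by simp
qed

text \<open>The increments \<open>B (Suc n) - B n\<close> are pairwise disjoint with the same
  supremum as \<open>B\<close>, and their measures telescope. Starting at \<open>bot\<close> ensures
  that no initial piece is missed.\<close>

lemma measure_incseq_tendsto:
  assumes "incseq B" and "B 0 = bot"
  shows "(\<lambda>n. \<mu> (B n)) \<longlonglongrightarrow> \<mu> (SUP n. B n)"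
proof -
  define A where "A n = B (Suc n) - B n" for n
  have step: "B n \<le> B (Suc n)" for n
    using assms(1) by (simp add: incseq_SucD)
  have disj: "inf (A m) (A n) = bot" if "m < n" for m n
  proof -
    have "A m \<le> B n"
      using that monoD[OF assms(1), of "Suc m" n]
      by (auto simp: A_def diff_eq intro: le_infI1)
    then have "inf (A m) (A n) \<le> inf (B n) (- B n)"
      by (intro inf_mono) (auto simp: A_def diff_eq)
    then show ?thesis
      by (simp add: bot_unique)
  qed
  have "inf (A m) (A n) = bot" if "m \<noteq> n" for m n
    using that disj[of m n] disj[of n m] by (metis inf_commute linorder_neqE_nat)
  then have "(\<lambda>n. \<mu> (A n)) sums \<mu> (SUP n. A n)"
    by (rule countably_additive)
  moreover have "(SUP n. A n) = (SUP n. B n)"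
  proof (rule antisym)
    have "A n \<le> (SUP n. B n)" for n
      by (rule order_trans[OF _ ccSUP_upper[of _ "Suc n"]]) (auto simp: A_def diff_eq)
    then show "(SUP n. A n) \<le> (SUP n. B n)"
      by (intro ccSUP_least) auto
    have "B n \<le> (SUP n. A n)" for n
    proof (induction n)
      case 0
      then show ?case by (simp add: assms(2))
    next
      case (Suc n)
      have "B (Suc n) = sup (B n) (A n)"
        using step[of n] by (simp add: A_def diff_eq sup_inf_distrib1 sup_absorb2)
      moreover have "A n \<le> (SUP n. A n)"
        by (rule ccSUP_upper) auto
      ultimately show ?case
        using Suc by simp
    qed
    then show "(SUP n. B n) \<le> (SUP n. A n)"
      by (intro ccSUP_least) auto
  qed
  moreover have "(\<Sum>i<n. \<mu> (A i)) = \<mu> (B n)" for n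
    using step assms(2)
    by (simp add: A_def measure_diff sum_lessThan_telescope[of "\<lambda>i. \<mu> (B i)"] measure_bot)
  ultimately show ?thesis
    by (simp add: sums_def)
qed

section \<open>Small elements and Sierpinski's theorem\<close>

lemma exists_half:
  assumes "a \<noteq> bot"
  shows "\<exists>b\<le>a. b \<noteq> bot \<and> \<mu> b \<le> \<mu> a / 2"
proof -
  obtain b where b: "b \<le> a" "b \<noteq> bot" "b \<noteq> a"
    using atomless[of a] assms by (auto simp: is_atom_def)
  have "a - b \<noteq> bot"
  proof
    assume "a - b = bot"
    then have "a \<le> b"
      by (simp add: diff_eq inf_shunt)
    then show False
      using b by simp
  qed
  moreover have "a - b \<le> a"
    by (simp add: diff_eq)
  \<comment> \<open>The measures of the two nonzero pieces add up to \<open>\<mu> a\<close>, so one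
    of them is at most half of it.\<close>
  moreover have "\<mu> b \<le> \<mu> a / 2 \<or> \<mu> (a - b) \<le> \<mu> a / 2"
    using measure_diff[OF b(1)] by linarith
  ultimately show ?thesis
    using b by blast
qed

lemma exists_small:
  assumes "a \<noteq> bot" and "0 < \<epsilon>"
  shows "\<exists>b\<le>a. b \<noteq> bot \<and> \<mu> b < \<epsilon>"
proof -
  have iter: "\<exists>b\<le>a. b \<noteq> bot \<and> \<mu> b \<le> \<mu> a / 2 ^ n" for n
  proof (induction n)
    case 0
    then show ?case using assms(1) by auto
  next
    case (Suc n)
    then obtain b where b: "b \<le> a" "b \<noteq> bot" "\<mu> b \<le> \<mu> a / 2 ^ n"
      by blast
    obtain d where d: "d \<le> b" "d \<noteq> bot" "\<mu> d \<le> \<mu> b / 2"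
      using exists_half[OF b(2)] by blast
    have "\<mu> b / 2 \<le> \<mu> a / 2 ^ Suc n"
      using divide_right_mono[OF b(3), of 2] by (simp add: mult.commute)
    with b(1) d show ?case
      by (intro exI[of _ d]) auto
  qed
  obtain n where n: "(1 / 2) ^ n < \<epsilon>"
    using real_arch_pow_inv[OF assms(2), of "1 / 2"] by auto
  have "\<mu> a / 2 ^ n \<le> (1 / 2) ^ n"
    using unit_interval[of a] by (simp add: field_simps)
  with n iter[of n] show ?thesis
    by fastforce
qed

text \<open>The supremum of the admissible measures might not be attained, but half of the possible
  gain always is. Quantifying over all competitors \<open>e\<close> keeps the supremum itself out of
  the later argument.\<close>

lemma greedy_step:
  assumes "b \<le> c" and "\<mu> b \<le> t"
  shows "\<exists>d. b \<le> d \<and> d \<le> c \<and> \<mu> d \<le> t \<and>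
    (\<forall>e. b \<le> e \<longrightarrow> e \<le> c \<longrightarrow> \<mu> e \<le> t \<longrightarrow> \<mu> e - \<mu> b \<le> 2 * (\<mu> d - \<mu> b))"
proof -
  define S where "S = {e. b \<le> e \<and> e \<le> c \<and> \<mu> e \<le> t}"
  define s where "s = (SUP e\<in>S. \<mu> e)"
  have bS: "b \<in> S"
    using assms by (simp add: S_def)
  have bdd: "bdd_above (\<mu> ` S)"
    by (rule bdd_aboveI[of _ t]) (auto simp: S_def)
  have up: "\<mu> e \<le> s" if "e \<in> S" for e
    unfolding s_def using bdd that by (rule cSUP_upper2) simp
  have "\<exists>d\<in>S. s - \<mu> b \<le> 2 * (\<mu> d - \<mu> b)"
  proof (cases "\<mu> b < s")
    case True
    \<comment> \<open>The midpoint lies strictly below the supremum, so some admissible element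
      exceeds it and gains more than half.\<close>
    then have "(s + \<mu> b) / 2 < s"
      by simp
    then obtain d where "d \<in> S" "(s + \<mu> b) / 2 < \<mu> d"
      using bS bdd unfolding s_def by (subst (asm) less_cSUP_iff) auto
    then show ?thesis
      by (intro bexI[of _ d]) auto
  next
    case False
    then show ?thesis
      \<comment> \<open>No admissible element has larger measure than \<open>b\<close>, so standing
        still suffices.\<close>
      using bS by (intro bexI[of _ b]) auto
  qed
  then obtain d where "d \<in> S" "s - \<mu> b \<le> 2 * (\<mu> d - \<mu> b)"
    by blast
  then show ?thesis
    using up by (intro exI[of _ d]) (fastforce simp: S_def)
qed

lemma exists_below:
  assumes "0 \<le> t" and "t \<le> \<mu> c"
  shows "\<exists>b\<le>c. \<mu> b = t"
proof -
  \<comment> \<open>Choice makes the greedy step a function; its iterates from \<open>bot\<close>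
    stay admissible, so its properties hold at every stage.\<close>
  obtain f where f: "\<And>b. b \<le> c \<Longrightarrow> \<mu> b \<le> t \<Longrightarrow> b \<le> f b \<and> f b \<le> c \<and> \<mu> (f b) \<le> t \<and>
      (\<forall>e. b \<le> e \<longrightarrow> e \<le> c \<longrightarrow> \<mu> e \<le> t \<longrightarrow> \<mu> e - \<mu> b \<le> 2 * (\<mu> (f b) - \<mu> b))"
    using greedy_step[of _ c t] by metis
  define B where "B n = (f ^^ n) bot" for n
  have B_Suc: "B (Suc n) = f (B n)" and B_0: "B 0 = bot" for n
    by (simp_all add: B_def)
  have B: "B n \<le> c \<and> \<mu> (B n) \<le> t" for n
    by (induction n) (use f assms in \<open>auto simp: B_0 B_Suc measure_bot\<close>)
  have inc: "incseq B"
    using f B by (intro incseq_SucI) (simp add: B_Suc)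
  define b where "b = (SUP n. B n)"
  have lim: "(\<lambda>n. \<mu> (B n)) \<longlonglongrightarrow> \<mu> b"
    unfolding b_def using inc B_0 by (rule measure_incseq_tendsto)
  have B_le: "B n \<le> b" for n
    unfolding b_def by (rule ccSUP_upper) auto
  have "b \<le> c"
    unfolding b_def using B by (intro ccSUP_least) auto
  have "\<mu> b \<le> t"
    using lim B by (intro LIMSEQ_le_const2[OF lim]) auto
  have "\<not> \<mu> b < t"
  proof
    assume less: "\<mu> b < t"
    then have "\<mu> (c - b) \<noteq> 0"
      using measure_diff[OF \<open>b \<le> c\<close>] assms(2) by simp
    then have "c - b \<noteq> bot"
      by (metis measure_bot)
    then obtain e where e: "e \<le> c - b" "e \<noteq> bot" "\<mu> e < t - \<mu> b"
      using exists_small[of "c - b" "t - \<mu> b"] less by auto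
    have e_c: "e \<le> c" and e_b: "e \<le> - b"
      using e(1) by (auto simp: diff_eq)
    \<comment> \<open>As \<open>e\<close> is disjoint from \<open>b\<close>, it is disjoint from
      every \<open>B n\<close>; hence \<open>sup (B n) e\<close> is an admissible competitor at each
      stage, with gain exactly \<open>\<mu> e\<close>.\<close>
    have "\<mu> e \<le> 2 * (\<mu> (B (Suc n)) - \<mu> (B n))" for n
    proof -
      have "inf (B n) e \<le> inf b (- b)"
        by (rule inf_mono) (use B_le e_b in auto)
      then have eq: "\<mu> (sup (B n) e) = \<mu> (B n) + \<mu> e"
        by (intro measure_sup) (simp add: bot_unique)
      moreover have "\<mu> (B n) \<le> \<mu> b"
        by (rule measure_mono[OF B_le])
      ultimately have "\<mu> (sup (B n) e) \<le> t"
        using e(3) by simp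
      then have "\<mu> (sup (B n) e) - \<mu> (B n) \<le> 2 * (\<mu> (f (B n)) - \<mu> (B n))"
        using f[of "B n"] B[of n] e_c by auto
      then show ?thesis
        by (simp add: eq B_Suc)
    qed
    \<comment> \<open>Both measures tend to \<open>\<mu> b\<close>, so the gains vanish in the
      limit, against \<open>0 < \<mu> e\<close>.\<close>
    moreover have "(\<lambda>n. 2 * (\<mu> (B (Suc n)) - \<mu> (B n))) \<longlonglongrightarrow> 2 * (\<mu> b - \<mu> b)"
      by (intro tendsto_intros LIMSEQ_Suc lim)
    ultimately have "\<mu> e \<le> 2 * (\<mu> b - \<mu> b)"
      by (intro LIMSEQ_le_const) auto
    with strictly_positive[OF e(2)] show False
      by simp
  qed
  with \<open>\<mu> b \<le> t\<close> \<open>b \<le> c\<close> show ?thesis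
    by force
qed

text \<open>The missing measure \<open>t - \<mu> l\<close> is found inside \<open>u - l\<close> and
  joined to \<open>l\<close>.\<close>

lemma intermediate_measure:
  assumes "l \<le> u" and "\<mu> l \<le> t" and "t \<le> \<mu> u"
  shows "\<exists>b. l \<le> b \<and> b \<le> u \<and> \<mu> b = t"
proof -
  obtain d where d: "d \<le> u - l" "\<mu> d = t - \<mu> l"
    using exists_below[of "t - \<mu> l" "u - l"] assms measure_diff[OF assms(1)] by auto
  have "d \<le> u" "d \<le> - l"
    using d(1) by (auto simp: diff_eq)
  then have "inf l d \<le> inf l (- l)"
    by (intro inf_mono) auto
  then have "\<mu> (sup l d) = t"
    using d(2) by (simp add: measure_sup bot_unique)
  with assms(1) \<open>d \<le> u\<close> show ?thesis
    by (intro exI[of _ "sup l d"]) auto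
qed

lemma exists_measure:
  assumes "x \<in> {0..1}"
  shows "\<exists>a. \<mu> a = x"
  using exists_below[of x top] assms by (auto simp: normalized)

section \<open>Extreme values of the meet\<close>

lemma star_least:
  assumes x: "x \<in> {0..1}" and y: "y \<in> {0..1}"
  shows "is_least (star \<mu> x y) (T_L x y)"
proof -
  obtain a where a: "\<mu> a = x"
    using exists_measure[OF x] by blast
  have compl: "\<mu> (- a) = 1 - x"
    using measure_diff[of a top] by (simp add: diff_eq a normalized)
  \<comment> \<open>The overlap with \<open>a\<close> is made as small as possible: \<open>b\<close>
    is put inside \<open>- a\<close> if it fits there. Otherwise \<open>b\<close> contains
    \<open>- a\<close>, the join is \<open>top\<close>, and modularity leaves
    \<open>x + y - 1\<close>.\<close>
  have "\<exists>b. \<mu> b = y \<and> \<mu> (inf a b) = T_L x y"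
  proof (cases "x + y \<le> 1")
    case True
    then obtain b where b: "b \<le> - a" "\<mu> b = y"
      using exists_below[of y "- a"] y compl by auto
    then have "inf a b \<le> inf a (- a)"
      by (intro inf_mono) auto
    then show ?thesis
      using True b(2) by (intro exI[of _ b]) (simp add: T_L_def bot_unique measure_bot)
  next
    case False
    then obtain b where b: "- a \<le> b" "\<mu> b = y"
      using intermediate_measure[of "- a" top y] y compl by (auto simp: normalized)
    have "sup a (- a) \<le> sup a b"
      by (intro sup_mono) (use b in auto)
    then have "\<mu> (sup a b) = 1"
      by (simp add: top_unique normalized)
    then show ?thesis
      using False b(2) a measure_sup_inf[of a b]
      by (intro exI[of _ b]) (auto simp: T_L_def)
  qed
  then have "T_L x y \<in> star \<mu> x y"
    using a by (force simp: star_def)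
  \<comment> \<open>This is modularity, with the measure of the join bounded by 1.\<close>
  moreover have "T_L (\<mu> a) (\<mu> b) \<le> \<mu> (inf a b)" for a b
    using measure_sup_inf[of a b] unit_interval[of "sup a b"] unit_interval[of "inf a b"]
    by (auto simp: T_L_def)
  then have "\<forall>s\<in>star \<mu> x y. T_L x y \<le> s"
    by (auto simp: star_def)
  ultimately show ?thesis
    by (simp add: is_least_def)
qed

lemma star_greatest:
  assumes x: "x \<in> {0..1}" and y: "y \<in> {0..1}"
  shows "is_greatest (star \<mu> x y) (T_G x y)"
proof -
  obtain a where a: "\<mu> a = x"
    using exists_measure[OF x] by blast
  \<comment> \<open>For comparable elements the meet is the smaller one, so its measure is the
    minimum.\<close>
  have "\<exists>b. \<mu> b = y \<and> (b \<le> a \<or> a \<le> b)"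
    using exists_below[of y a] intermediate_measure[of a top y] a y
    by (cases "y \<le> x") (auto simp: normalized)
  then obtain b where b: "\<mu> b = y" "b \<le> a \<or> a \<le> b"
    by blast
  from b(2) have "\<mu> (inf a b) = T_G x y"
    using measure_mono[of a b] measure_mono[of b a] a b(1)
    by (auto simp: T_G_def inf_absorb1 inf_absorb2)
  then have "T_G x y \<in> star \<mu> x y"
    using a b(1) by (force simp: star_def)
  moreover have "\<mu> (inf a b) \<le> T_G (\<mu> a) (\<mu> b)" for a b
    by (auto simp: T_G_def intro: measure_mono)
  then have "\<forall>s\<in>star \<mu> x y. s \<le> T_G x y"
    by (auto simp: star_def)
  ultimately show ?thesis
    by (simp add: is_greatest_def)
qed

end

section \<open>Rectangles in product measures\<close>

lemma measure_pair_Times: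
  assumes "finite_measure M" and "finite_measure N" and "a \<in> sets M" and "b \<in> sets N"
  shows "measure (M \<Otimes>\<^sub>M N) (a \<times> b) = measure M a * measure N b"
proof -
  interpret N: finite_measure N by fact
  \<comment> \<open>The extended-valued rectangle formula passes to the reals because
    \<open>enn2real\<close> is multiplicative.\<close>
  show ?thesis
    using N.emeasure_pair_measure_Times[OF assms(3,4)]
    by (simp add: measure_def enn2real_mult)
qed

section \<open>Residua and residual negations\<close>

lemma residuum_eqI:
  assumes "is_greatest {z \<in> {0..1}. T x z \<le> y} m"
  shows "residuum T x y = m"
  unfolding residuum_def
  by (rule Greatest_equality) (use assms in \<open>auto simp: is_greatest_def\<close>)

text \<open>Since \<open>0 \<le> y\<close>, the truncation at 0 is harmless and the condition is
  linear in \<open>z\<close>; the minimum keeps the solution in the unit interval.\<close>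

lemma greatest_T_L:
  assumes "x \<in> {0..1}" and "y \<in> {0..1}"
  shows "is_greatest {z \<in> {0..1}. T_L x z \<le> y} (min 1 (1 - x + y))"
  using assms by (auto simp: is_greatest_def T_L_def)

lemma greatest_T_G:
  assumes "x \<in> {0..1}" and "y \<in> {0..1}"
  shows "is_greatest {z \<in> {0..1}. T_G x z \<le> y} (if x \<le> y then 1 else y)"
  using assms by (auto simp: is_greatest_def T_G_def)

text \<open>If \<open>x \<le> y\<close>, then \<open>z = 1\<close> is admissible, also for
  \<open>x = 0\<close>. Otherwise \<open>0 \<le> y < x\<close>, so division by \<open>x\<close> is
  legitimate and the quotient is below 1.\<close>

lemma greatest_T_P:
  assumes "x \<in> {0..1}" and "y \<in> {0..1}"
  shows "is_greatest {z \<in> {0..1}. T_P x z \<le> y} (if x \<le> y then 1 else y / x)"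
  using assms by (auto simp: is_greatest_def T_P_def field_simps)

lemmas residuum_T_L = residuum_eqI[OF greatest_T_L]
  and residuum_T_G = residuum_eqI[OF greatest_T_G]
  and residuum_T_P = residuum_eqI[OF greatest_T_P]

theorem proposition7:
  fixes \<mu> :: "'a::{boolean_algebra, countable_complete_lattice} \<Rightarrow> real"
  assumes "atomless_measure_algebra \<mu>"
  shows
    "((\<forall>x\<in>{0..1}. \<forall>y\<in>{0..1}.
         is_least (star \<mu> x y) (T_L x y) \<and> is_greatest (star \<mu> x y) (T_G x y))
      \<and> (\<forall>(M\<^sub>1::'b measure) (M\<^sub>2::'c measure). prob_space M\<^sub>1 \<and> prob_space M\<^sub>2 \<longrightarrow>
           (\<forall>a\<in>sets M\<^sub>1. \<forall>b\<in>sets M\<^sub>2. \<forall>x y. measure M\<^sub>1 a = x \<and> measure M\<^sub>2 b = y \<longrightarrow>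
              measure (M\<^sub>1 \<Otimes>\<^sub>M M\<^sub>2) (a \<times> b) = T_P x y)))
     \<and>
     (\<forall>x\<in>{0..1}. \<forall>y\<in>{0..1}.
        (\<forall>T\<in>{T_L, T_G, T_P}. is_greatest {z \<in> {0..1}. T x z \<le> y} (residuum T x y))
        \<and> residuum T_L x y = min 1 (1 - x + y)
        \<and> residuum T_G x y = (if x \<le> y then 1 else y)
        \<and> residuum T_P x y = (if x \<le> y then 1 else y / x))
     \<and>
     ((\<forall>x\<in>{0..1}. residual_negation T_L x = 1 - x)
      \<and> \<not> (\<forall>x\<in>{0..1}. residual_negation T_G x = 1 - x)
      \<and> \<not> (\<forall>x\<in>{0..1}. residual_negation T_P x = 1 - x))"
proof -
  interpret atomless_measure_algebra \<mu> by fact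
  have "measure (M \<Otimes>\<^sub>M N) (a \<times> b) = T_P (measure M a) (measure N b)"
    if "prob_space M" "prob_space N" "a \<in> sets M" "b \<in> sets N"
    for M :: "'b measure" and N :: "'c measure" and a b
    using that by (simp add: T_P_def measure_pair_Times prob_space_def)
  \<comment> \<open>Rewriting each residuum to its closed form reduces attainment to the explicit
    greatest elements.\<close>
  moreover have "is_greatest {z \<in> {0..1}. T x z \<le> y} (residuum T x y)"
    if "x \<in> {0..1}" "y \<in> {0..1}" "T \<in> {T_L, T_G, T_P}" for x y T
    using that greatest_T_L[OF that(1,2)] greatest_T_G[OF that(1,2)] greatest_T_P[OF that(1,2)]
    by (auto simp only: residuum_T_L residuum_T_G residuum_T_P insert_iff empty_iff)
  moreover have "residual_negation T_L x = 1 - x" if "x \<in> {0..1}" for x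
    using that by (simp add: residual_negation_def residuum_T_L)
  \<comment> \<open>Both negations send every positive \<open>x\<close> to 0, so
    \<open>1 / 2\<close> is a counterexample for each.\<close>
  moreover have "\<not> (\<forall>x\<in>{0..1}. residual_negation T_G x = 1 - x)"
    "\<not> (\<forall>x\<in>{0..1}. residual_negation T_P x = 1 - x)"
    by (auto simp: residual_negation_def residuum_T_G residuum_T_P intro!: bexI[of _ "1 / 2"])
  ultimately show ?thesis
    by (intro conjI ballI allI impI)
      (auto simp only: star_least star_greatest residuum_T_L residuum_T_G residuum_T_P)
qed

end
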